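(* Let $\mathfrak{g},\tilde{\mathfrak{g}}$ be finite dimensional Lie algebras over $\mathbb{F}\in\{\mathbb{R},\mathbb{C}\}$ with $\tilde{\mathfrak g}$ simple, and let $\sigma\in\mathrm{Aut}\,\mathfrak g$, $\tilde\sigma\in\mathrm{Aut}\,\tilde{\mathfrak g}$. Let $\varphi:L(\mathfrak g,\sigma)\to L(\tilde{\mathfrak g},\tilde\sigma)$ be a surjective homomorphism of Lie algebras (only assumed $\mathbb{F}$-linear and bracket preserving, no continuity). Then $\varphi$ is standard.
   Context: For a finite dimensional Lie algebra $\mathfrak g$ over $\mathbb F$ and $\sigma\in\mathrm{Aut}\,\mathfrak g$ (not necessarily of finite order), the twisted loop algebra is $L(\mathfrak g,\sigma)=\{u:\mathbb{R}\to\mathfrak g \text{ smooth}\mid u(t+2\pi)=\sigma u(t)\ \forall t\}$ with pointwise bracket $[u,v]_0(t)=[u(t),v(t)]$. A homomorphism $\varphi:L(\mathfrak g,\sigma)\to L(\tilde{\mathfrak g},\tilde\sigma)$ is called standard if there exist a smooth function $\lambda:\mathbb{R}\to\mathbb{R}$ and Lie algebra homomorphisms $\varphi_t:\mathfrak g\to\tilde{\mathfrak g}$ depending smoothly on $t\in\mathbb R$ such that $(\varphi u)(t)=\varphi_t(u(\lambda(t)))$ for all $u$ and $t$. *)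

theory Defs
  imports "HOL-Analysis.Analysis"
begin

definition vderiv :: "(real \<Rightarrow> 'a::real_normed_vector) \<Rightarrow> real \<Rightarrow> 'a" where
  "vderiv f = (\<lambda>t. vector_derivative f (at t))"

definition smooth_fun :: "(real \<Rightarrow> 'a::real_normed_vector) \<Rightarrow> bool" where
  "smooth_fun f \<longleftrightarrow> (\<forall>n t. ((vderiv ^^ n) f) differentiable (at t))"

definition lie_algebra :: "('k::field \<Rightarrow> 'a \<Rightarrow> 'a::ab_group_add) \<Rightarrow> ('a \<Rightarrow> 'a \<Rightarrow> 'a) \<Rightarrow> bool" where
  "lie_algebra sc br \<longleftrightarrow> vector_space sc
     \<and> (\<forall>x y z. br (x + y) z = br x z + br y z)
     \<and> (\<forall>x y z. br x (y + z) = br x y + br x z)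
     \<and> (\<forall>c x y. br (sc c x) y = sc c (br x y))
     \<and> (\<forall>c x y. br x (sc c y) = sc c (br x y))
     \<and> (\<forall>x. br x x = 0)
     \<and> (\<forall>x y z. br x (br y z) + br y (br z x) + br z (br x y) = 0)"

definition lie_hom :: "('k::field \<Rightarrow> 'a \<Rightarrow> 'a::ab_group_add) \<Rightarrow> ('a \<Rightarrow> 'a \<Rightarrow> 'a)
     \<Rightarrow> ('k \<Rightarrow> 'b \<Rightarrow> 'b::ab_group_add) \<Rightarrow> ('b \<Rightarrow> 'b \<Rightarrow> 'b) \<Rightarrow> ('a \<Rightarrow> 'b) \<Rightarrow> bool" where
  "lie_hom sc1 br1 sc2 br2 f \<longleftrightarrow> Vector_Spaces.linear sc1 sc2 f
     \<and> (\<forall>x y. f (br1 x y) = br2 (f x) (f y))"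

definition lie_aut :: "('k::field \<Rightarrow> 'a \<Rightarrow> 'a::ab_group_add) \<Rightarrow> ('a \<Rightarrow> 'a \<Rightarrow> 'a) \<Rightarrow> ('a \<Rightarrow> 'a) \<Rightarrow> bool" where
  "lie_aut sc br f \<longleftrightarrow> lie_hom sc br sc br f \<and> bij f"

definition lie_ideal :: "('k::field \<Rightarrow> 'a \<Rightarrow> 'a::ab_group_add) \<Rightarrow> ('a \<Rightarrow> 'a \<Rightarrow> 'a) \<Rightarrow> 'a set \<Rightarrow> bool" where
  "lie_ideal sc br I \<longleftrightarrow> module.subspace sc I \<and> (\<forall>x\<in>I. \<forall>y. br y x \<in> I)"

definition simple_lie :: "('k::field \<Rightarrow> 'a \<Rightarrow> 'a::ab_group_add) \<Rightarrow> ('a \<Rightarrow> 'a \<Rightarrow> 'a) \<Rightarrow> bool" where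
  "simple_lie sc br \<longleftrightarrow> (\<exists>x y. br x y \<noteq> 0)
     \<and> (\<forall>I. lie_ideal sc br I \<longrightarrow> I = {0} \<or> I = UNIV)"

definition loop_alg :: "('a::real_normed_vector \<Rightarrow> 'a) \<Rightarrow> (real \<Rightarrow> 'a) set" where
  "loop_alg \<sigma> = {u. smooth_fun u \<and> (\<forall>t. u (t + 2 * pi) = \<sigma> (u t))}"

definition loop_hom ::
  "('k::field \<Rightarrow> 'a \<Rightarrow> 'a::real_normed_vector) \<Rightarrow> ('a \<Rightarrow> 'a \<Rightarrow> 'a) \<Rightarrow> ('a \<Rightarrow> 'a)
   \<Rightarrow> ('k \<Rightarrow> 'b \<Rightarrow> 'b::real_normed_vector) \<Rightarrow> ('b \<Rightarrow> 'b \<Rightarrow> 'b) \<Rightarrow> ('b \<Rightarrow> 'b)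
   \<Rightarrow> ((real \<Rightarrow> 'a) \<Rightarrow> (real \<Rightarrow> 'b)) \<Rightarrow> bool" where
  "loop_hom sc1 br1 \<sigma>1 sc2 br2 \<sigma>2 \<phi> \<longleftrightarrow>
     (\<forall>u\<in>loop_alg \<sigma>1. \<phi> u \<in> loop_alg \<sigma>2)
   \<and> (\<forall>u\<in>loop_alg \<sigma>1. \<forall>v\<in>loop_alg \<sigma>1. \<phi> (\<lambda>t. u t + v t) = (\<lambda>t. \<phi> u t + \<phi> v t))
   \<and> (\<forall>c. \<forall>u\<in>loop_alg \<sigma>1. \<phi> (\<lambda>t. sc1 c (u t)) = (\<lambda>t. sc2 c (\<phi> u t)))
   \<and> (\<forall>u\<in>loop_alg \<sigma>1. \<forall>v\<in>loop_alg \<sigma>1.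
        \<phi> (\<lambda>t. br1 (u t) (v t)) = (\<lambda>t. br2 (\<phi> u t) (\<phi> v t)))"

text \<open>Standard homomorphisms: (phi u)(t) = phi_t (u (lambda t)) with lambda smooth and
  phi_t Lie algebra homomorphisms depending smoothly on t (for linear maps between
  finite dimensional spaces, smooth dependence is equivalent to smoothness of
  t \<mapsto> phi_t x for every x).\<close>
definition standard_hom ::
  "('k::field \<Rightarrow> 'a \<Rightarrow> 'a::real_normed_vector) \<Rightarrow> ('a \<Rightarrow> 'a \<Rightarrow> 'a) \<Rightarrow> ('a \<Rightarrow> 'a)
   \<Rightarrow> ('k \<Rightarrow> 'b \<Rightarrow> 'b::real_normed_vector) \<Rightarrow> ('b \<Rightarrow> 'b \<Rightarrow> 'b)
   \<Rightarrow> ((real \<Rightarrow> 'a) \<Rightarrow> (real \<Rightarrow> 'b)) \<Rightarrow> bool" where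
  "standard_hom sc1 br1 \<sigma>1 sc2 br2 \<phi> \<longleftrightarrow>
     (\<exists>(lam :: real \<Rightarrow> real) (\<Phi> :: real \<Rightarrow> 'a \<Rightarrow> 'b).
        smooth_fun lam
      \<and> (\<forall>t. lie_hom sc1 br1 sc2 br2 (\<Phi> t))
      \<and> (\<forall>x. smooth_fun (\<lambda>t. \<Phi> t x))
      \<and> (\<forall>u\<in>loop_alg \<sigma>1. \<forall>t. \<phi> u t = \<Phi> t (u (lam t))))"

end

theory Submission
  imports Defs
begin

text \<open>
  Fix \<open>t\<close> and compose \<open>\<phi>\<close> with evaluation at \<open>t\<close>; this gives a surjection \<open>\<psi>\<close> of the loop algebra
  onto the simple algebra. Since \<open>[f u, v] = [u, f v]\<close> for a \<open>2\<pi>\<close>-periodic real function \<open>f\<close> and the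
  centre of a simple algebra is trivial, \<open>ker \<psi>\<close> is stable under multiplication by \<open>f\<close>, and periodic
  functions act on the quotient through its centroid. By Schur's lemma and finite dimensionality, the
  functions acting by zero form a prime ideal modulo which every function is algebraic over the
  reals; such an ideal consists of the functions vanishing at some point \<open>p\<close>. Hence \<open>f u\<close> is mapped
  to \<open>f(p) \<psi>(u)\<close>, and localizing at \<open>p\<close> shows that \<open>\<psi>(u)\<close> depends only on \<open>u(p)\<close>. Letting \<open>t\<close> vary,
  \<open>f \<circ> p\<close> is smooth for every \<open>f\<close>; applied to \<open>cos\<close> and \<open>sin\<close> this allows \<open>p\<close> to be replaced modulo
  \<open>2\<pi>\<close> by a smooth function.
\<close>

section \<open>Smooth functions of a real variable\<close>

definition higher_differentiable_on ::
    "nat \<Rightarrow> real set \<Rightarrow> (real \<Rightarrow> 'a::real_normed_vector) \<Rightarrow> bool" where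
  "higher_differentiable_on n S f \<longleftrightarrow> (\<forall>k<n. \<forall>t\<in>S. (vderiv ^^ k) f differentiable (at t))"

definition smooth_on :: "real set \<Rightarrow> (real \<Rightarrow> 'a::real_normed_vector) \<Rightarrow> bool" where
  "smooth_on S f \<longleftrightarrow> (\<forall>n. higher_differentiable_on n S f)"

lemma smooth_fun_iff_smooth_on: "smooth_fun f \<longleftrightarrow> smooth_on UNIV f"
  by (auto simp: smooth_fun_def smooth_on_def higher_differentiable_on_def)

lemma has_vector_derivative_vderiv:
  "f differentiable (at t) \<Longrightarrow> (f has_vector_derivative vderiv f t) (at t)"
  by (simp add: vderiv_def vector_derivative_works)

lemma vderiv_eqI: "(f has_vector_derivative d) (at t) \<Longrightarrow> vderiv f t = d"
  by (simp add: vderiv_def vector_derivative_at)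

lemma higher_differentiable_on_0 [simp]: "higher_differentiable_on 0 S f"
  by (simp add: higher_differentiable_on_def)

lemma higher_differentiable_on_Suc:
  "higher_differentiable_on (Suc n) S f \<longleftrightarrow>
    (\<forall>t\<in>S. f differentiable (at t)) \<and> higher_differentiable_on n S (vderiv f)"
  unfolding higher_differentiable_on_def less_Suc_eq_0_disj by (auto simp: funpow_swap1)

lemma higher_differentiable_on_SucD:
  "higher_differentiable_on (Suc n) S f \<Longrightarrow> higher_differentiable_on n S f"
  by (simp add: higher_differentiable_on_def)

lemma higher_differentiable_on_cong:
  assumes "open S" "\<And>t. t \<in> S \<Longrightarrow> f t = g t" "higher_differentiable_on n S f"
  shows "higher_differentiable_on n S g"
  using assms(2,3)
proof (induction n arbitrary: f g)
  case (Suc n)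
  have deriv: "(g has_vector_derivative vderiv f t) (at t)" if "t \<in> S" for t
  proof (rule has_vector_derivative_transform_within_open[OF _ assms(1) that])
    show "(f has_vector_derivative vderiv f t) (at t)"
      using Suc.prems(2) that
      by (intro has_vector_derivative_vderiv) (simp add: higher_differentiable_on_Suc)
  qed (use Suc.prems(1) in auto)
  have "higher_differentiable_on n S (vderiv g)"
  proof (rule Suc.IH)
    show "vderiv f t = vderiv g t" if "t \<in> S" for t
      using vderiv_eqI[OF deriv[OF that]] by simp
    show "higher_differentiable_on n S (vderiv f)"
      using Suc.prems(2) by (simp add: higher_differentiable_on_Suc)
  qed
  then show ?case
    using deriv by (auto simp: higher_differentiable_on_Suc intro: differentiableI_vector)
qed simp

lemma higher_differentiable_on_SucI:
  assumes "open S" "\<And>t. t \<in> S \<Longrightarrow> (f has_vector_derivative f' t) (at t)"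
    and "higher_differentiable_on n S f'"
  shows "higher_differentiable_on (Suc n) S f"
proof -
  have "higher_differentiable_on n S (vderiv f)"
    by (rule higher_differentiable_on_cong[OF assms(1) _ assms(3)])
       (simp add: vderiv_eqI[OF assms(2)])
  then show ?thesis
    using assms(2) by (auto simp: higher_differentiable_on_Suc intro: differentiableI_vector)
qed

lemma higher_differentiable_on_add:
  assumes "open S" "higher_differentiable_on n S f" "higher_differentiable_on n S g"
  shows "higher_differentiable_on n S (\<lambda>t. f t + g t)"
  using assms(2,3)
proof (induction n arbitrary: f g)
  case (Suc n)
  then show ?case
    by (intro higher_differentiable_on_SucI[where f' = "\<lambda>t. vderiv f t + vderiv g t"] assms)
       (auto simp: higher_differentiable_on_Suc
         intro!: has_vector_derivative_add has_vector_derivative_vderiv)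
qed simp

lemma higher_differentiable_on_bilinear:
  assumes "bounded_bilinear b" "open S"
    and "higher_differentiable_on n S f" "higher_differentiable_on n S g"
  shows "higher_differentiable_on n S (\<lambda>t. b (f t) (g t))"
  using assms(3,4)
proof (induction n arbitrary: f g)
  case (Suc n)
  let ?d = "\<lambda>t. b (f t) (vderiv g t) + b (vderiv f t) (g t)"
  have "higher_differentiable_on n S ?d"
    using Suc.prems Suc.prems[THEN higher_differentiable_on_SucD]
    by (intro higher_differentiable_on_add Suc.IH assms(2))
       (simp_all add: higher_differentiable_on_Suc)
  then show ?case
    using Suc.prems
    by (intro higher_differentiable_on_SucI[where f' = ?d])
       (auto simp: higher_differentiable_on_Suc assms(2)
         intro!: bounded_bilinear.has_vector_derivative[OF assms(1)] has_vector_derivative_vderiv)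
qed simp

lemma smooth_on_has_vderiv:
  "smooth_on S f \<Longrightarrow> t \<in> S \<Longrightarrow> (f has_vector_derivative vderiv f t) (at t)"
  unfolding smooth_on_def
  by (rule has_vector_derivative_vderiv) (metis higher_differentiable_on_Suc)

lemma smooth_on_vderiv: "smooth_on S f \<Longrightarrow> smooth_on S (vderiv f)"
  unfolding smooth_on_def by (metis higher_differentiable_on_Suc)

lemma smooth_on_imp_continuous_on: "smooth_on S f \<Longrightarrow> continuous_on S f"
  by (auto simp: continuous_on_eq_continuous_within
      intro: has_vector_derivative_continuous[THEN continuous_at_imp_continuous_at_within]
        smooth_on_has_vderiv)

lemma smooth_on_subset: "smooth_on S f \<Longrightarrow> T \<subseteq> S \<Longrightarrow> smooth_on T f"
  unfolding smooth_on_def higher_differentiable_on_def by blast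

lemma smooth_on_locally:
  assumes "\<And>t. t \<in> S \<Longrightarrow> \<exists>T. t \<in> T \<and> smooth_on T f"
  shows "smooth_on S f"
  using assms unfolding smooth_on_def higher_differentiable_on_def by blast

lemma smooth_on_cong:
  "open S \<Longrightarrow> (\<And>t. t \<in> S \<Longrightarrow> f t = g t) \<Longrightarrow> smooth_on S f \<Longrightarrow> smooth_on S g"
  unfolding smooth_on_def by (blast intro: higher_differentiable_on_cong)

lemma smooth_on_from_derivative:
  assumes "open S" "\<And>t. t \<in> S \<Longrightarrow> (f has_vector_derivative f' t) (at t)" "smooth_on S f'"
  shows "smooth_on S f"
  unfolding smooth_on_def
  using assms(3) higher_differentiable_on_SucI[OF assms(1,2), THEN higher_differentiable_on_SucD]
  by (simp add: smooth_on_def)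

lemma smooth_on_derivative_closed_family:
  assumes "open S" "\<And>i t. t \<in> S \<Longrightarrow> (F i has_vector_derivative F (d i) t) (at t)"
  shows "smooth_on S (F i)"
proof -
  have "higher_differentiable_on n S (F i)" for n
  proof (induction n arbitrary: i)
    case (Suc n)
    show ?case by (rule higher_differentiable_on_SucI[OF assms Suc.IH])
  qed simp
  then show ?thesis by (simp add: smooth_on_def)
qed

lemma smooth_on_const: "open S \<Longrightarrow> smooth_on S (\<lambda>_. c)"
  by (rule smooth_on_derivative_closed_family[where F = "\<lambda>c _. c" and d = "\<lambda>_. 0"])
     (auto intro: has_vector_derivative_const)

lemma smooth_on_ident: "open S \<Longrightarrow> smooth_on S (\<lambda>t. t)"
  by (rule smooth_on_from_derivative[OF _ _ smooth_on_const[of S 1]])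
     (auto intro: has_vector_derivative_id)

lemma smooth_on_sin:
  assumes "open S"
  shows "smooth_on S (sin :: real \<Rightarrow> real)"
proof -
  let ?F = "\<lambda>k t. sin (t + real k * (pi / 2))"
  have "smooth_on S (?F 0)"
  proof (rule smooth_on_derivative_closed_family[OF assms, where F = ?F and d = Suc])
    fix k t
    have "t + real (Suc k) * (pi / 2) = (t + real k * (pi / 2)) + pi / 2"
      by (simp add: field_simps)
    then have "cos (t + real k * (pi / 2)) = sin (t + real (Suc k) * (pi / 2))"
      by (simp only: sin_add[of _ "pi / 2"]) simp
    then show "(?F k has_vector_derivative ?F (Suc k) t) (at t)"
      unfolding has_real_derivative_iff_has_vector_derivative[symmetric]
      by (auto intro!: derivative_eq_intros)
  qed
  then show ?thesis by simp
qed

lemma smooth_on_inverse_id: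
  assumes S: "open S" "0 \<notin> S"
  shows "smooth_on S (inverse :: real \<Rightarrow> real)"
proof -
  let ?F = "\<lambda>(c, k) t. c * inverse t ^ k :: real" and ?d = "\<lambda>(c, k). (- c * real k, Suc k)"
  have "smooth_on S (?F (1, 1))"
  proof (rule smooth_on_derivative_closed_family[OF S(1), where d = ?d])
    fix i :: "real \<times> nat" and t assume "t \<in> S"
    obtain c k where i: "i = (c, k)" by fastforce
    have "t \<noteq> 0" using \<open>t \<in> S\<close> S(2) by blast
    then have "(?F i has_real_derivative
        c * (real k * (- (inverse t ^ Suc (Suc 0)) * inverse t ^ (k - Suc 0)))) (at t)"
      unfolding i split by (intro DERIV_cmult DERIV_power DERIV_inverse)
    also have "c * (real k * (- (inverse t ^ Suc (Suc 0)) * inverse t ^ (k - Suc 0))) = ?F (?d i) t"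
      by (cases k) (auto simp: i)
    finally show "(?F i has_vector_derivative ?F (?d i) t) (at t)"
      by (simp add: has_real_derivative_iff_has_vector_derivative)
  qed
  then show ?thesis by simp
qed

lemma smooth_on_add:
  "open S \<Longrightarrow> smooth_on S f \<Longrightarrow> smooth_on S g \<Longrightarrow> smooth_on S (\<lambda>t. f t + g t)"
  by (simp add: smooth_on_def higher_differentiable_on_add)

lemma smooth_on_bilinear:
  "bounded_bilinear b \<Longrightarrow> open S \<Longrightarrow> smooth_on S f \<Longrightarrow> smooth_on S g \<Longrightarrow>
    smooth_on S (\<lambda>t. b (f t) (g t))"
  by (simp add: smooth_on_def higher_differentiable_on_bilinear)

lemmas smooth_on_scaleR = smooth_on_bilinear[OF bounded_bilinear_scaleR]
lemmas smooth_on_inner = smooth_on_bilinear[OF bounded_bilinear_inner]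
lemmas smooth_on_mult = smooth_on_bilinear[OF bounded_bilinear_mult]

lemma smooth_on_bounded_linear:
  assumes "bounded_linear T" "open S" "smooth_on S f"
  shows "smooth_on S (\<lambda>t. T (f t))"
proof -
  have "smooth_on S (\<lambda>t. T ((vderiv ^^ 0) f t))"
  proof (rule smooth_on_derivative_closed_family[OF assms(2), where d = Suc])
    have "smooth_on S ((vderiv ^^ k) f)" for k
      by (induction k) (simp_all add: assms(3) smooth_on_vderiv)
    then show "((\<lambda>t. T ((vderiv ^^ k) f t)) has_vector_derivative T ((vderiv ^^ Suc k) f t)) (at t)"
      if "t \<in> S" for k t
      using that
      by (auto intro: bounded_linear.has_vector_derivative[OF assms(1)] smooth_on_has_vderiv)
  qed
  then show ?thesis by simp
qed

lemma smooth_on_diff: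
  assumes "open S" "smooth_on S f" "smooth_on S g"
  shows "smooth_on S (\<lambda>t. f t - g t)"
  using smooth_on_add[OF assms(1,2) smooth_on_bounded_linear[OF _ assms(1,3), of uminus]]
  by (simp add: bounded_linear_minus[OF bounded_linear_ident])

lemma smooth_on_compose:
  assumes "open S" "open T" "g ` S \<subseteq> T" "smooth_on T f" "smooth_on S g"
  shows "smooth_on S (\<lambda>t. f (g t))"
proof -
  have "higher_differentiable_on n S (\<lambda>t. f (g t))" for n
    using assms(4)
  proof (induction n arbitrary: f)
    case (Suc n)
    show ?case
    proof (rule higher_differentiable_on_SucI[OF assms(1)])
      show "((\<lambda>t. f (g t)) has_vector_derivative vderiv g t *\<^sub>R vderiv f (g t)) (at t)"
        if "t \<in> S" for t
      proof -
        have "g t \<in> T" using that assms(3) by blast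
        then show ?thesis
          using vector_diff_chain_at[of g _ t f] smooth_on_has_vderiv[OF assms(5) that]
            smooth_on_has_vderiv[OF Suc.prems] by (simp add: o_def)
      qed
      show "higher_differentiable_on n S (\<lambda>t. vderiv g t *\<^sub>R vderiv f (g t))"
        using smooth_on_vderiv[OF assms(5)] Suc.IH[OF smooth_on_vderiv[OF Suc.prems]]
        by (intro higher_differentiable_on_bilinear[OF bounded_bilinear_scaleR assms(1)])
           (simp_all add: smooth_on_def)
    qed
  qed simp
  then show ?thesis by (simp add: smooth_on_def)
qed

lemma smooth_on_cos:
  assumes "open S"
  shows "smooth_on S (cos :: real \<Rightarrow> real)"
proof -
  have "smooth_on S (\<lambda>t. sin (pi / 2 - t))"
    by (intro smooth_on_compose[OF _ open_UNIV _ smooth_on_sin[OF open_UNIV]] smooth_on_diff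
        smooth_on_const smooth_on_ident assms subset_UNIV)
  then show ?thesis by (simp add: sin_diff)
qed

lemma smooth_on_inverse:
  fixes f :: "real \<Rightarrow> real"
  assumes "open S" "smooth_on S f" "\<And>t. t \<in> S \<Longrightarrow> f t \<noteq> 0"
  shows "smooth_on S (\<lambda>t. inverse (f t))"
  by (rule smooth_on_compose[where T = "- {0}", OF assms(1)])
     (use assms in \<open>auto intro!: smooth_on_inverse_id\<close>)

lemma smooth_on_scalar_factor:
  fixes g :: "real \<Rightarrow> real"
  assumes "open S"
    and factor: "\<And>a. a \<in> S \<Longrightarrow>
      \<exists>v :: real \<Rightarrow> 'a::real_inner. smooth_on S v \<and> v a \<noteq> 0 \<and> smooth_on S (\<lambda>t. g t *\<^sub>R v t)"
  shows "smooth_on S g"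
proof (rule smooth_on_locally)
  fix a assume "a \<in> S"
  then obtain v :: "real \<Rightarrow> 'a"
    where v: "smooth_on S v" "v a \<noteq> 0" "smooth_on S (\<lambda>t. g t *\<^sub>R v t)"
    using factor by blast
  define T where "T = S \<inter> (\<lambda>t. v t \<bullet> v a) -` (- {0})"
  have inner: "smooth_on S (\<lambda>t. v t \<bullet> v a)" "smooth_on S (\<lambda>t. (g t *\<^sub>R v t) \<bullet> v a)"
    by (intro smooth_on_inner v smooth_on_const \<open>open S\<close>)+
  have "open T"
    unfolding T_def
    by (intro continuous_open_preimage smooth_on_imp_continuous_on inner(1) \<open>open S\<close>) auto
  have "smooth_on T (\<lambda>t. ((g t *\<^sub>R v t) \<bullet> v a) * inverse (v t \<bullet> v a))"
    by (intro smooth_on_mult smooth_on_inverse \<open>open T\<close> inner[THEN smooth_on_subset])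
       (auto simp: T_def)
  then have "smooth_on T g"
    by (rule smooth_on_cong[OF \<open>open T\<close>, rotated]) (simp add: T_def)
  moreover have "a \<in> T"
    using \<open>a \<in> S\<close> v(2) by (simp add: T_def)
  ultimately show "\<exists>T. a \<in> T \<and> smooth_on T g" by blast
qed

section \<open>A bump function\<close>

definition flat :: "real poly \<Rightarrow> real \<Rightarrow> real" where
  "flat q x = (if x \<le> 0 then 0 else poly q (inverse x) * exp (- inverse x))"

lemma flat_tendsto_0: "(flat q \<longlongrightarrow> 0) (at 0)"
proof -
  have "((\<lambda>y::real. \<Sum>k\<le>degree q. coeff q k * (y ^ k / exp y)) \<longlongrightarrow>
      (\<Sum>k\<le>degree q. coeff q k * 0)) at_top"
    by (intro tendsto_sum tendsto_mult tendsto_const tendsto_power_div_exp_0)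
  then have "((\<lambda>y. poly q y * exp (- y)) \<longlongrightarrow> 0) at_top"
    by (simp add: poly_altdef sum_distrib_right exp_minus divide_inverse mult.assoc)
  then have "((\<lambda>x. poly q (inverse x) * exp (- inverse x)) \<longlongrightarrow> 0) (at_right 0)"
    by (rule filterlim_compose[OF _ filterlim_inverse_at_top_right])
  then have "(flat q \<longlongrightarrow> 0) (at_right 0)"
    by (rule Lim_transform_eventually)
       (auto simp: flat_def intro: eventually_mono[OF eventually_at_right_less])
  moreover have "(flat q \<longlongrightarrow> 0) (at_left 0)"
    by (rule Lim_transform_eventually[OF tendsto_const])
       (auto simp: flat_def intro!: eventually_at_leftI[of "-1"])
  ultimately show ?thesis by (rule filterlim_split_at_real[rotated])
qed

lemma flat_has_derivative:
  "(flat q has_real_derivative flat (pCons 0 (pCons 0 (q - pderiv q))) x) (at x)"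
proof -
  consider (negative) "x < 0" | (zero) "x = 0" | (positive) "x > 0" by linarith
  then show ?thesis
  proof cases
    case negative
    have "((\<lambda>_. 0) has_real_derivative 0) (at x)" by simp
    then have "(flat q has_real_derivative 0) (at x)"
      by (rule has_field_derivative_transform_within_open[where S = "{..<0}"])
         (use negative in \<open>auto simp: flat_def\<close>)
    with negative show ?thesis by (simp add: flat_def)
  next
    case zero
    have "((\<lambda>h. (flat q (0 + h) - flat q 0) / h) \<longlongrightarrow> 0) (at 0)"
      using flat_tendsto_0[of "pCons 0 q"]
      by (rule Lim_transform_eventually) (auto simp: flat_def field_simps intro!: always_eventually)
    with zero show ?thesis by (simp add: DERIV_def flat_def)
  next
    case positive
    have "((\<lambda>x. poly q (inverse x) * exp (- inverse x)) has_real_derivative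
        flat (pCons 0 (pCons 0 (q - pderiv q))) x) (at x)"
      using positive
      by (auto intro!: derivative_eq_intros poly_DERIV[THEN DERIV_chain2]
          simp: flat_def algebra_simps)
    then show ?thesis
      by (rule has_field_derivative_transform_within_open[where S = "{0<..}"])
         (use positive in \<open>auto simp: flat_def\<close>)
  qed
qed

lemma smooth_on_flat: "smooth_on UNIV (flat q)"
  by (rule smooth_on_derivative_closed_family[where F = flat
        and d = "\<lambda>q. pCons 0 (pCons 0 (q - pderiv q))"])
     (auto simp: flat_has_derivative simp flip: has_real_derivative_iff_has_vector_derivative)

definition bump :: "real \<Rightarrow> real" where
  "bump x = exp 1 * flat 1 (1 - x * x)"

lemma bump_0 [simp]: "bump 0 = 1"
  by (simp add: bump_def flat_def flip: exp_add)

lemma bump_pos: "\<bar>x\<bar> < 1 \<Longrightarrow> bump x > 0"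
  using abs_square_less_1[of x] by (simp add: bump_def flat_def power2_eq_square)

lemma bump_eq_0: "\<bar>x\<bar> \<ge> 1 \<Longrightarrow> bump x = 0"
  using abs_le_square_iff[of 1 x] by (simp add: bump_def flat_def power2_eq_square)

lemma smooth_on_bump: "open S \<Longrightarrow> smooth_on S f \<Longrightarrow> smooth_on S (\<lambda>t. bump (f t))"
  unfolding bump_def
  by (intro smooth_on_mult smooth_on_const smooth_on_diff
      smooth_on_compose[where f = "flat 1", OF _ _ _ smooth_on_flat]) auto

section \<open>Smooth angle functions\<close>

lemma smooth_on_antiderivative:
  fixes w :: "real \<Rightarrow> 'a::euclidean_space"
  assumes "smooth_on UNIV w"
  obtains F where "smooth_on UNIV F" "F 0 = a" "\<And>t. (F has_vector_derivative w t) (at t)"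
proof -
  have "isCont w t" for t
    using smooth_on_imp_continuous_on[OF assms] by (simp add: continuous_on_eq_continuous_at)
  then obtain G where G: "\<And>t. (G has_vector_derivative w t) (at t)"
    using einterval_antiderivative[of "-\<infinity>" "\<infinity>" w] by auto
  define F where "F t = G t - G 0 + a" for t
  have F: "(F has_vector_derivative w t) (at t)" for t
    unfolding F_def using G[of t] by (auto intro!: derivative_eq_intros)
  then have "smooth_on UNIV F"
    by (intro smooth_on_from_derivative[OF open_UNIV _ assms])
  then show ?thesis by (rule that[OF _ _ F]) (simp add: F_def)
qed

lemma unit_circle_derivative:
  fixes c s :: "real \<Rightarrow> real"
  assumes c: "(c has_real_derivative c') (at t)" and s: "(s has_real_derivative s') (at t)"
    and unit: "\<And>t. (c t)\<^sup>2 + (s t)\<^sup>2 = 1"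
  shows "c' = - s t * (c t * s' - s t * c')" "s' = c t * (c t * s' - s t * c')"
proof -
  have "((\<lambda>t. (c t)\<^sup>2 + (s t)\<^sup>2) has_real_derivative 2 * (c t * c' + s t * s')) (at t)"
    by (auto intro!: derivative_eq_intros c s)
  moreover have "((\<lambda>t. (c t)\<^sup>2 + (s t)\<^sup>2) has_real_derivative 0) (at t)"
    by (simp add: unit)
  ultimately have orthogonal: "c t * c' + s t * s' = 0"
    using DERIV_unique by fastforce
  show "c' = - s t * (c t * s' - s t * c')" "s' = c t * (c t * s' - s t * c')"
    using orthogonal unit[of t] by algebra+
qed

lemma cos_sin_of_angular_velocity:
  fixes c s \<theta> w :: "real \<Rightarrow> real"
  assumes c: "\<And>t. (c has_real_derivative - s t * w t) (at t)"
    and s: "\<And>t. (s has_real_derivative c t * w t) (at t)"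
    and \<theta>: "\<And>t. (\<theta> has_real_derivative w t) (at t)"
    and initial: "c 0 = cos (\<theta> 0)" "s 0 = sin (\<theta> 0)"
  shows "cos (\<theta> t) = c t" "sin (\<theta> t) = s t"
proof -
  let ?d = "\<lambda>t. (cos (\<theta> t) - c t)\<^sup>2 + (sin (\<theta> t) - s t)\<^sup>2"
  have "(?d has_real_derivative 0) (at t)" for t
    by (rule derivative_eq_intros c s \<theta> refl)+ (simp add: algebra_simps)
  then have "?d t = ?d 0"
    using DERIV_isconst_all by blast
  also have "\<dots> = 0" by (simp add: initial)
  finally show "cos (\<theta> t) = c t" "sin (\<theta> t) = s t"
    by (simp_all add: sum_power2_eq_zero_iff)
qed

lemma smooth_angle_lift:
  fixes c s :: "real \<Rightarrow> real"
  assumes c: "smooth_on UNIV c" and s: "smooth_on UNIV s" and unit: "\<And>t. (c t)\<^sup>2 + (s t)\<^sup>2 = 1"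
  obtains \<theta> where "smooth_on UNIV \<theta>" "\<And>t. cos (\<theta> t) = c t" "\<And>t. sin (\<theta> t) = s t"
proof -
  define w where "w t = c t * vderiv s t - s t * vderiv c t" for t
  have "smooth_on UNIV w"
    unfolding w_def by (intro smooth_on_diff smooth_on_mult smooth_on_vderiv c s open_UNIV)
  obtain a where a: "c 0 = cos a" "s 0 = sin a"
    using sincos_total_2pi[OF unit[of 0]] by metis
  obtain \<theta> where \<theta>: "smooth_on UNIV \<theta>" "\<theta> 0 = a" "\<And>t. (\<theta> has_vector_derivative w t) (at t)"
    by (rule smooth_on_antiderivative[OF \<open>smooth_on UNIV w\<close>, of a]) blast
  have derivs: "(c has_real_derivative vderiv c t) (at t)"
      "(s has_real_derivative vderiv s t) (at t)" for t
    using smooth_on_has_vderiv[OF c] smooth_on_has_vderiv[OF s]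
    by (simp_all add: has_real_derivative_iff_has_vector_derivative)
  have velocity: "vderiv c t = - s t * w t" "vderiv s t = c t * w t" for t
    unfolding w_def by (rule unit_circle_derivative[OF derivs unit])+
  have "cos (\<theta> t) = c t" "sin (\<theta> t) = s t" for t
    using cos_sin_of_angular_velocity[of c s w \<theta> t] derivs[unfolded velocity] \<theta>(2,3) a
    by (simp_all add: has_real_derivative_iff_has_vector_derivative)
  with \<theta>(1) show ?thesis by (rule that)
qed

section \<open>Twisted loops\<close>

definition int_funpow :: "('a \<Rightarrow> 'a) \<Rightarrow> int \<Rightarrow> 'a \<Rightarrow> 'a" where
  "int_funpow f n = (if n \<ge> 0 then f ^^ nat n else inv f ^^ nat (- n))"

lemma int_funpow_0 [simp]: "int_funpow f 0 x = x"
  by (simp add: int_funpow_def)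

lemma int_funpow_add_one:
  assumes "bij f"
  shows "int_funpow f (n + 1) x = f (int_funpow f n x)"
proof (cases n)
  case (nonneg m)
  then show ?thesis by (simp add: int_funpow_def nat_add_distrib)
next
  case (neg m)
  then have "nat (- n) = Suc m" "nat (- (n + 1)) = m" by auto
  moreover have "f (inv f y) = y" for y
    using assms by (simp add: bij_is_surj surj_f_inv_f)
  ultimately show ?thesis
    using neg by (cases m) (auto simp: int_funpow_def)
qed

lemma bij_int_funpow: "bij f \<Longrightarrow> bij (int_funpow f n)"
  by (simp add: int_funpow_def bij_imp_bij_inv)

lemma linear_funpow:
  fixes f :: "'a::real_vector \<Rightarrow> 'a"
  shows "linear f \<Longrightarrow> linear (f ^^ n)"
  by (induction n) (simp_all add: linear_id linear_compose)

lemma linear_int_funpow: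
  fixes f :: "'a::euclidean_space \<Rightarrow> 'a"
  assumes "linear f" "bij f"
  shows "linear (int_funpow f n)"
  using assms inj_linear_imp_inv_linear[of f]
  by (simp add: int_funpow_def linear_funpow linear_linear bij_is_inj)

definition winding :: "real \<Rightarrow> real \<Rightarrow> int" where
  "winding a t = \<lfloor>(t - a + pi) / (2 * pi)\<rfloor>"

abbreviation period_around :: "real \<Rightarrow> real set" where
  "period_around a \<equiv> {a - pi..<a + pi}"

lemma winding_eq_iff: "winding a t = k \<longleftrightarrow> t - 2 * pi * of_int k \<in> period_around a"
  by (auto simp: winding_def floor_eq_iff field_simps)

lemma winding_in_period: "t - 2 * pi * of_int (winding a t) \<in> period_around a"
  using winding_eq_iff by blast

lemma loop_alg_iff:
  "u \<in> loop_alg \<sigma> \<longleftrightarrow> smooth_on UNIV u \<and> (\<forall>t. u (t + 2 * pi) = \<sigma> (u t))"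
  by (simp add: loop_alg_def smooth_fun_iff_smooth_on)

lemma loop_alg_smooth: "u \<in> loop_alg \<sigma> \<Longrightarrow> smooth_on UNIV u"
  by (simp add: loop_alg_iff)

lemma loop_alg_bounded_linear:
  assumes "bounded_linear T" "\<And>x. T (\<sigma> x) = \<tau> (T x)" "u \<in> loop_alg \<sigma>"
  shows "(\<lambda>t. T (u t)) \<in> loop_alg \<tau>"
  using assms by (auto simp: loop_alg_iff intro: smooth_on_bounded_linear)

lemma loop_alg_bilinear:
  assumes "bounded_bilinear b" "\<And>x y. b (\<sigma> x) (\<tau> y) = \<upsilon> (b x y)" "u \<in> loop_alg \<sigma>" "v \<in> loop_alg \<tau>"
  shows "(\<lambda>t. b (u t) (v t)) \<in> loop_alg \<upsilon>"
  using assms by (auto simp: loop_alg_iff intro: smooth_on_bilinear)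

abbreviation periodic :: "(real \<Rightarrow> real) set" where
  "periodic \<equiv> loop_alg (\<lambda>x. x)"

definition twisted_extension :: "('a \<Rightarrow> 'a) \<Rightarrow> real \<Rightarrow> (real \<Rightarrow> 'a) \<Rightarrow> real \<Rightarrow> 'a" where
  "twisted_extension \<sigma> a h t = int_funpow \<sigma> (winding a t) (h (t - 2 * pi * of_int (winding a t)))"

lemma twisted_extension_eq: "t \<in> period_around a \<Longrightarrow> twisted_extension \<sigma> a h t = h t"
  using winding_eq_iff[of a t 0] by (simp add: twisted_extension_def)

definition loop_bump :: "('a::real_vector \<Rightarrow> 'a) \<Rightarrow> real \<Rightarrow> 'a \<Rightarrow> real \<Rightarrow> 'a" where
  "loop_bump \<sigma> a x = twisted_extension \<sigma> a (\<lambda>t. bump (t - a) *\<^sub>R x)"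

lemma loop_bump_eq: "t \<in> period_around a \<Longrightarrow> loop_bump \<sigma> a x t = bump (t - a) *\<^sub>R x"
  by (simp add: loop_bump_def twisted_extension_eq)

lemma loop_bump_center [simp]: "loop_bump \<sigma> a x a = x"
  by (simp add: loop_bump_eq)

locale twisted_loops =
  fixes \<sigma> :: "'a::euclidean_space \<Rightarrow> 'a"
  assumes linear_twist: "linear \<sigma>" and bij_twist: "bij \<sigma>"
begin

lemma equivariant_shift:
  assumes "\<And>t. u (t + 2 * pi) = \<sigma> (u t)"
  shows "u (t + 2 * pi * of_int n) = int_funpow \<sigma> n (u t)"
proof (induction n rule: int_induct[where k = 0])
  case base
  then show ?case by simp
next
  case (step1 n)
  have "u (t + 2 * pi * of_int (n + 1)) = u (t + 2 * pi * of_int n + 2 * pi)"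
    by (simp add: algebra_simps)
  also have "\<dots> = \<sigma> (int_funpow \<sigma> n (u t))"
    by (simp add: assms step1)
  finally show ?case by (simp add: int_funpow_add_one[OF bij_twist])
next
  case (step2 n)
  have "\<sigma> (u (t + 2 * pi * of_int (n - 1))) = u (t + 2 * pi * of_int n)"
    unfolding assms[symmetric] by (simp add: algebra_simps)
  also have "\<dots> = \<sigma> (int_funpow \<sigma> (n - 1) (u t))"
    using step2 int_funpow_add_one[OF bij_twist, of "n - 1"] by simp
  finally show ?case
    using bij_twist by (simp add: bij_def inj_eq)
qed

lemma loop_eq_shift_iff:
  assumes "u \<in> loop_alg \<sigma>" "v \<in> loop_alg \<sigma>"
  shows "u (t + 2 * pi * of_int n) = v (t + 2 * pi * of_int n) \<longleftrightarrow> u t = v t"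
proof -
  have "w (t + 2 * pi * of_int n) = int_funpow \<sigma> n (w t)" if "w \<in> loop_alg \<sigma>" for w
    using that by (intro equivariant_shift) (simp add: loop_alg_iff)
  from this[OF assms(1)] this[OF assms(2)] show ?thesis
    by (simp add: inj_eq[OF bij_is_inj[OF bij_int_funpow[OF bij_twist]]])
qed

lemma loop_eqI:
  assumes "u \<in> loop_alg \<sigma>" "v \<in> loop_alg \<sigma>" "\<And>t. t \<in> period_around a \<Longrightarrow> u t = v t"
  shows "u = v"
proof
  fix t
  show "u t = v t"
    using loop_eq_shift_iff[OF assms(1,2), of "t - 2 * pi * of_int (winding a t)" "winding a t"]
      assms(3)[OF winding_in_period] by simp
qed

lemma loop_zero: "(\<lambda>_. 0) \<in> loop_alg \<sigma>"
  by (simp add: loop_alg_iff smooth_on_const linear_0[OF linear_twist])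

lemma loop_add: "u \<in> loop_alg \<sigma> \<Longrightarrow> v \<in> loop_alg \<sigma> \<Longrightarrow> (\<lambda>t. u t + v t) \<in> loop_alg \<sigma>"
  by (simp add: loop_alg_iff smooth_on_add linear_add[OF linear_twist])

lemma loop_diff: "u \<in> loop_alg \<sigma> \<Longrightarrow> v \<in> loop_alg \<sigma> \<Longrightarrow> (\<lambda>t. u t - v t) \<in> loop_alg \<sigma>"
  by (simp add: loop_alg_iff smooth_on_diff linear_diff[OF linear_twist])

lemma loop_scaleR: "u \<in> loop_alg \<sigma> \<Longrightarrow> (\<lambda>t. r *\<^sub>R u t) \<in> loop_alg \<sigma>"
  by (rule loop_alg_bounded_linear[OF bounded_linear_scaleR_right])
     (simp_all add: linear_scale[OF linear_twist])

lemma loop_periodic_scaleR: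
  "f \<in> periodic \<Longrightarrow> u \<in> loop_alg \<sigma> \<Longrightarrow> (\<lambda>t. f t *\<^sub>R u t) \<in> loop_alg \<sigma>"
  by (rule loop_alg_bilinear[OF bounded_bilinear_scaleR])
     (simp_all add: linear_scale[OF linear_twist])

lemma loop_sum: "(\<And>i. i \<in> I \<Longrightarrow> u i \<in> loop_alg \<sigma>) \<Longrightarrow> (\<lambda>t. \<Sum>i\<in>I. u i t) \<in> loop_alg \<sigma>"
  by (induction I rule: infinite_finite_induct) (simp_all add: loop_zero loop_add)

lemma loop_algI_local:
  assumes equivariant: "\<And>t. w (t + 2 * pi) = \<sigma> (w t)"
    and S: "open S" "period_around a \<subseteq> S" "smooth_on S w"
  shows "w \<in> loop_alg \<sigma>"
proof -
  have "smooth_on UNIV w"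
  proof (rule smooth_on_locally)
    fix t
    define n where "n = winding a t"
    define T where "T = (\<lambda>t. t - 2 * pi * of_int n) -` S"
    have "open T"
      unfolding T_def by (intro open_vimage S continuous_intros)
    have "smooth_on T (\<lambda>t. w (t - 2 * pi * of_int n))"
    proof (rule smooth_on_compose[OF \<open>open T\<close> S(1) _ S(3)])
      show "(\<lambda>t. t - 2 * pi * of_int n) ` T \<subseteq> S"
        by (auto simp: T_def)
      show "smooth_on T (\<lambda>t. t - 2 * pi * of_int n)"
        by (intro smooth_on_diff smooth_on_ident smooth_on_const \<open>open T\<close>)
    qed
    then have "smooth_on T (\<lambda>t. int_funpow \<sigma> n (w (t - 2 * pi * of_int n)))"
      by (rule smooth_on_bounded_linear[rotated 2])
         (simp_all add: linear_int_funpow linear_twist bij_twist \<open>open T\<close>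
           flip: linear_conv_bounded_linear)
    then have "smooth_on T w"
      by (rule smooth_on_cong[OF \<open>open T\<close>, rotated])
         (simp add: equivariant_shift[of w, OF equivariant, symmetric])
    moreover have "t \<in> T"
      using S(2) winding_in_period[of t a] by (auto simp: T_def n_def)
    ultimately show "\<exists>T. t \<in> T \<and> smooth_on T w" by blast
  qed
  with equivariant show ?thesis by (simp add: loop_alg_iff)
qed

lemma twisted_extension_equivariant:
  "twisted_extension \<sigma> a h (t + 2 * pi) = \<sigma> (twisted_extension \<sigma> a h t)"
proof -
  have "winding a (t + 2 * pi) = winding a t + 1"
    unfolding winding_eq_iff using winding_in_period[of t a] by (auto simp: algebra_simps)
  then show ?thesis
    by (simp add: twisted_extension_def int_funpow_add_one[OF bij_twist] distrib_left)
qed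

lemma twisted_extension_in_loop_alg:
  assumes h: "smooth_on UNIV h" and supp: "\<And>t. \<bar>t - a\<bar> \<ge> r \<Longrightarrow> h t = 0" and r: "0 \<le> r" "r < pi"
  shows "twisted_extension \<sigma> a h \<in> loop_alg \<sigma>"
proof (rule loop_algI_local[where a = a])
  define w where "w = twisted_extension \<sigma> a h"
  let ?A = "{a - pi - (pi - r)<..<a - pi + (pi - r)}" and ?B = "{a - pi<..<a + pi}"
  have "w t = 0" if "t \<in> ?A" for t
  proof (cases "t < a - pi")
    case True
    then have "winding a t = -1"
      unfolding winding_eq_iff using that r by auto
    moreover have "h (t + 2 * pi) = 0"
      by (rule supp) (use that in auto)
    ultimately show ?thesis
      using linear_int_funpow[OF linear_twist bij_twist, THEN linear_0]
      by (simp add: w_def twisted_extension_def)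
  next
    case False
    then show ?thesis
      using that supp[of t] r by (subst w_def, subst twisted_extension_eq) auto
  qed
  then have "smooth_on ?A w"
    by (intro smooth_on_cong[OF _ _ smooth_on_const[of _ 0]]) auto
  moreover have "smooth_on ?B w"
    by (rule smooth_on_cong[OF _ _ smooth_on_subset[OF h]]) (auto simp: w_def twisted_extension_eq)
  ultimately show "smooth_on (?A \<union> ?B) (twisted_extension \<sigma> a h)"
    unfolding w_def by (intro smooth_on_locally) blast
  show "period_around a \<subseteq> ?A \<union> ?B"
    using r by auto
qed (auto simp: twisted_extension_equivariant)

lemma loop_bump_in_loop_alg: "loop_bump \<sigma> a x \<in> loop_alg \<sigma>"
  unfolding loop_bump_def
  by (rule twisted_extension_in_loop_alg[where r = 1])
     (use pi_gt3 in \<open>auto simp: bump_eq_0 intro!: smooth_on_scaleR smooth_on_bump smooth_on_diff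
        smooth_on_ident smooth_on_const\<close>)

end

interpretation periodic: twisted_loops "\<lambda>x::real. x"
  by unfold_locales (simp_all add: linear_id[unfolded id_def] bij_id[unfolded id_def])

lemma periodic_const: "(\<lambda>_. c) \<in> periodic"
  by (simp add: loop_alg_iff smooth_on_const)

lemma periodic_mult: "f \<in> periodic \<Longrightarrow> g \<in> periodic \<Longrightarrow> (\<lambda>t. f t * g t) \<in> periodic"
  by (simp add: loop_alg_iff smooth_on_mult)

lemma periodic_power: "f \<in> periodic \<Longrightarrow> (\<lambda>t. f t ^ k) \<in> periodic"
  by (induction k) (simp_all add: periodic_const periodic_mult)

lemma periodic_poly: "f \<in> periodic \<Longrightarrow> (\<lambda>t. poly q (f t)) \<in> periodic"
  unfolding poly_altdef by (intro periodic.loop_sum periodic_mult periodic_const periodic_power)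

lemma periodic_inverse: "f \<in> periodic \<Longrightarrow> (\<And>t. f t \<noteq> 0) \<Longrightarrow> (\<lambda>t. inverse (f t)) \<in> periodic"
  by (simp add: loop_alg_iff smooth_on_inverse)

lemma periodic_cos: "cos \<in> periodic" and periodic_sin: "sin \<in> periodic"
  by (simp_all add: loop_alg_iff smooth_on_cos smooth_on_sin)

definition local_coordinate :: "real \<Rightarrow> (real \<Rightarrow> 'a::real_inner) \<Rightarrow> 'a \<Rightarrow> real \<Rightarrow> real" where
  "local_coordinate p u b = twisted_extension (\<lambda>x. x) p (\<lambda>t. bump (t - p) * (u t \<bullet> b))"

lemma local_coordinate_eq:
  "t \<in> period_around p \<Longrightarrow> local_coordinate p u b t = bump (t - p) * (u t \<bullet> b)"
  by (simp add: local_coordinate_def twisted_extension_eq)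

lemma periodic_local_coordinate:
  assumes "smooth_on UNIV u"
  shows "local_coordinate p u b \<in> periodic"
  unfolding local_coordinate_def
  by (rule periodic.twisted_extension_in_loop_alg[where r = 1])
     (use pi_gt3 assms in \<open>auto simp: bump_eq_0 intro!: smooth_on_mult smooth_on_bump
        smooth_on_diff smooth_on_ident smooth_on_inner smooth_on_const\<close>)

text \<open>The bump is squared because neither the coordinates of \<open>u\<close> nor the constant basis vectors need
  extend to loops: both have to be cut off.\<close>

lemma (in twisted_loops) square_bump_scaleR_eq_sum_Basis:
  assumes u: "u \<in> loop_alg \<sigma>"
  shows "(\<lambda>t. (loop_bump (\<lambda>x. x) p 1 t)\<^sup>2 *\<^sub>R u t) =
    (\<lambda>t. \<Sum>b\<in>Basis. local_coordinate p u b t *\<^sub>R loop_bump \<sigma> p b t)"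
proof (rule loop_eqI)
  fix t assume t: "t \<in> period_around p"
  have "(\<Sum>b\<in>Basis. local_coordinate p u b t *\<^sub>R loop_bump \<sigma> p b t) =
      (\<Sum>b\<in>Basis. (bump (t - p))\<^sup>2 *\<^sub>R (u t \<bullet> b) *\<^sub>R b)"
    using t by (intro sum.cong) (simp_all add: local_coordinate_eq loop_bump_eq power2_eq_square)
  also have "\<dots> = (bump (t - p))\<^sup>2 *\<^sub>R u t"
    by (simp only: scaleR_sum_right[symmetric] euclidean_representation)
  finally show "(loop_bump (\<lambda>x. x) p 1 t)\<^sup>2 *\<^sub>R u t =
      (\<Sum>b\<in>Basis. local_coordinate p u b t *\<^sub>R loop_bump \<sigma> p b t)"
    using t by (simp add: loop_bump_eq)
qed (intro loop_sum loop_periodic_scaleR periodic_power periodic_local_coordinate u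
    loop_alg_smooth[OF u] loop_bump_in_loop_alg periodic.loop_bump_in_loop_alg)+

section \<open>Algebraic prime ideals of smooth periodic functions\<close>

locale algebraic_prime_ideal =
  fixes I :: "(real \<Rightarrow> real) set"
  assumes subset_periodic: "I \<subseteq> periodic"
    and add_closed: "f \<in> I \<Longrightarrow> g \<in> I \<Longrightarrow> (\<lambda>t. f t + g t) \<in> I"
    and mult_closed: "f \<in> I \<Longrightarrow> g \<in> periodic \<Longrightarrow> (\<lambda>t. f t * g t) \<in> I"
    and one_notin: "(\<lambda>_. 1) \<notin> I"
    and prime: "f \<in> periodic \<Longrightarrow> g \<in> periodic \<Longrightarrow> (\<lambda>t. f t * g t) \<in> I \<Longrightarrow> f \<in> I \<or> g \<in> I"
    and algebraic: "f \<in> periodic \<Longrightarrow> \<exists>q. q \<noteq> 0 \<and> (\<lambda>t. poly q (f t)) \<in> I"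
begin

lemma square_closed: "f \<in> I \<Longrightarrow> (\<lambda>t. (f t)\<^sup>2) \<in> I"
  using mult_closed subset_periodic by (auto simp: power2_eq_square)

lemma exists_zero:
  assumes "f \<in> I"
  shows "\<exists>t. f t = 0"
proof (rule ccontr)
  assume "\<nexists>t. f t = 0"
  then have "(\<lambda>t. f t * inverse (f t)) \<in> I"
    using assms subset_periodic by (intro mult_closed periodic_inverse) auto
  with \<open>\<nexists>t. f t = 0\<close> one_notin show False by simp
qed

text \<open>By \<open>exists_zero\<close>, a polynomial relation for \<open>f\<close> modulo \<open>I\<close> has a real root; by primality
  either the corresponding linear factor is a relation or the degree can be lowered.\<close>

lemma exists_residue:
  assumes f: "f \<in> periodic"
  shows "\<exists>r. (\<lambda>t. f t - r) \<in> I"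
proof -
  obtain q where "q \<noteq> 0" "(\<lambda>t. poly q (f t)) \<in> I"
    using algebraic[OF f] by blast
  then show ?thesis
  proof (induction "degree q" arbitrary: q rule: less_induct)
    case less
    obtain t where "poly q (f t) = 0"
      using exists_zero[OF less.prems(2)] by blast
    then obtain q' where q: "q = [:- f t, 1:] * q'"
      by (auto simp: poly_eq_0_iff_dvd)
    with less.prems(1) have "q' \<noteq> 0" by auto
    then have "degree q' < degree q"
      unfolding q by (subst degree_mult_eq) auto
    have "(\<lambda>s. (f s - f t) * poly q' (f s)) \<in> I"
      using less.prems(2) by (simp add: q algebra_simps)
    then have "(\<lambda>s. f s - f t) \<in> I \<or> (\<lambda>s. poly q' (f s)) \<in> I"
      by (intro prime periodic.loop_diff periodic_poly periodic_const f)
    then show ?case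
      using less.hyps \<open>q' \<noteq> 0\<close> \<open>degree q' < degree q\<close> by blast
  qed
qed

text \<open>The residues of \<open>cos\<close> and \<open>sin\<close> determine the point modulo \<open>2\<pi>\<close>.\<close>

lemma exists_common_zero: "\<exists>p. \<forall>f\<in>I. f p = 0"
proof -
  obtain c s where cs: "(\<lambda>t. cos t - c) \<in> I" "(\<lambda>t. sin t - s) \<in> I"
    using exists_residue periodic_cos periodic_sin by metis
  have zero: "\<exists>t. f t = 0 \<and> cos t = c \<and> sin t = s" if "f \<in> I" for f
  proof -
    have "(\<lambda>t. (f t)\<^sup>2 + ((cos t - c)\<^sup>2 + (sin t - s)\<^sup>2)) \<in> I"
      by (intro add_closed square_closed that cs)
    then obtain t where "(f t)\<^sup>2 + ((cos t - c)\<^sup>2 + (sin t - s)\<^sup>2) = 0"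
      using exists_zero by blast
    then show ?thesis
      by (intro exI[of _ t]) (simp add: add_nonneg_eq_0_iff sum_power2_eq_zero_iff)
  qed
  obtain p where p: "cos p = c" "sin p = s"
    using zero[OF cs(1)] by blast
  have "f p = 0" if f: "f \<in> I" for f
  proof -
    obtain t where t: "f t = 0" "cos t = cos p" "sin t = sin p"
      using zero[OF f] by (auto simp: p)
    then obtain n :: int where "p = t + 2 * pi * n"
      using sin_cos_eq_iff[of p t] by auto
    then show ?thesis
      using periodic.loop_eq_shift_iff[of f "\<lambda>_. 0" t n] periodic.loop_zero f subset_periodic t(1)
      by auto
  qed
  then show ?thesis by blast
qed

theorem eq_vanishing_ideal: "\<exists>p. I = {f \<in> periodic. f p = 0}"
proof -
  obtain p where p: "\<And>f. f \<in> I \<Longrightarrow> f p = 0"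
    using exists_common_zero by blast
  have "f \<in> I" if f: "f \<in> periodic" "f p = 0" for f
  proof -
    obtain r where r: "(\<lambda>t. f t - r) \<in> I"
      using exists_residue[OF f(1)] by blast
    with p[OF r] f(2) show ?thesis by simp
  qed
  with p subset_periodic show ?thesis by blast
qed

end

section \<open>Lie algebras over Euclidean spaces\<close>

text \<open>The map \<open>\<rho>\<close> embeds the reals into the ground field, so that both ground fields of interest are
  covered.\<close>

locale euclidean_lie_algebra =
  fixes sc :: "'k::field \<Rightarrow> 'a::euclidean_space \<Rightarrow> 'a" and br :: "'a \<Rightarrow> 'a \<Rightarrow> 'a" and \<rho> :: "real \<Rightarrow> 'k"
  assumes lie_algebra: "lie_algebra sc br" and scale_real: "sc (\<rho> r) x = r *\<^sub>R x"
begin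

sublocale vs: vector_space sc
  using lie_algebra by (simp add: lie_algebra_def)

lemma scale_scaleR: "sc c (r *\<^sub>R x) = r *\<^sub>R sc c x"
  unfolding scale_real[symmetric] by (rule vs.scale_left_commute)

lemma bounded_linear_scale: "bounded_linear (sc c)"
  unfolding linear_conv_bounded_linear[symmetric]
  by (rule linearI) (simp_all add: scale_scaleR vs.scale_right_distrib)

lemma bracket_scale: "br (sc c x) y = sc c (br x y)" "br x (sc c y) = sc c (br x y)"
  using lie_algebra by (simp_all add: lie_algebra_def)

sublocale bracket: bounded_bilinear br
proof -
  have "bilinear br"
    using lie_algebra bracket_scale[where c = "\<rho> r" for r]
    by (simp add: bilinear_def linear_iff lie_algebra_def scale_real)
  then show "bounded_bilinear br"
    by (simp add: bilinear_conv_bounded_bilinear)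
qed

lemma simple_center_trivial:
  assumes "simple_lie sc br" "\<And>y. br y x = 0"
  shows "x = 0"
proof -
  let ?Z = "{x. \<forall>y. br y x = 0}"
  have "lie_ideal sc br ?Z"
    by (auto simp: lie_ideal_def vs.subspace_def bracket.add_right bracket.zero_right bracket_scale)
  then have "?Z = {0} \<or> ?Z = UNIV"
    using assms(1) by (simp add: simple_lie_def)
  moreover have "?Z \<noteq> UNIV"
    using assms(1) by (auto simp: simple_lie_def)
  ultimately show ?thesis using assms(2) by blast
qed

lemma simple_centroid_zero_or_injective:
  assumes "simple_lie sc br" "Vector_Spaces.linear sc sc T" "\<And>x y. T (br y x) = br y (T x)"
    and "T x = 0"
  shows "x = 0 \<or> T y = 0"
proof -
  interpret T: Vector_Spaces.linear sc sc T by fact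
  have "lie_ideal sc br {x. T x = 0}"
    using T.subspace_kernel by (simp add: lie_ideal_def assms(3) bracket.zero_right)
  then have "{x. T x = 0} = {0} \<or> {x. T x = 0} = UNIV"
    using assms(1) by (simp add: simple_lie_def)
  with assms(4) show ?thesis by blast
qed

end

lemma lie_hom_linear:
  assumes "lie_hom sc br sc' br' f"
    and "\<And>r x. sc (\<rho> r) x = r *\<^sub>R x" "\<And>r y. sc' (\<rho> r) y = r *\<^sub>R y"
  shows "linear f"
  using assms(1) unfolding lie_hom_def Vector_Spaces.linear_iff linear_iff
  by (metis assms(2,3))

locale twisted_lie_algebra = euclidean_lie_algebra sc br \<rho>
  for sc :: "'k::field \<Rightarrow> 'a::euclidean_space \<Rightarrow> 'a" and br \<rho> +
  fixes \<sigma> :: "'a \<Rightarrow> 'a"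
  assumes aut: "lie_aut sc br \<sigma>"
begin

sublocale twisted_loops \<sigma>
  using aut lie_hom_linear[of sc br sc br \<sigma> \<rho>]
  by (intro twisted_loops.intro) (simp_all add: lie_aut_def scale_real)

lemma loop_bracket: "u \<in> loop_alg \<sigma> \<Longrightarrow> v \<in> loop_alg \<sigma> \<Longrightarrow> (\<lambda>t. br (u t) (v t)) \<in> loop_alg \<sigma>"
  using aut by (intro loop_alg_bilinear[OF bracket.bounded_bilinear_axioms])
    (auto simp: lie_aut_def lie_hom_def)

lemma loop_scale: "u \<in> loop_alg \<sigma> \<Longrightarrow> (\<lambda>t. sc c (u t)) \<in> loop_alg \<sigma>"
  using aut by (intro loop_alg_bounded_linear[OF bounded_linear_scale])
    (auto simp: lie_aut_def lie_hom_def Vector_Spaces.linear_iff)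

end

section \<open>Simple quotients of loop algebras\<close>

lemma sum_coeff_scaleR_upto_degree:
  fixes q :: "real poly" and v :: "nat \<Rightarrow> 'b::real_vector"
  assumes "degree q \<le> n"
  shows "(\<Sum>k\<le>degree q. coeff q k *\<^sub>R v k) = (\<Sum>k\<le>n. coeff q k *\<^sub>R v k)"
  using assms by (intro sum.mono_neutral_left) (auto simp: coeff_eq_0)

lemma exists_poly_relation:
  fixes v :: "nat \<Rightarrow> 'b::euclidean_space"
  shows "\<exists>q :: real poly. q \<noteq> 0 \<and> (\<Sum>k\<le>degree q. coeff q k *\<^sub>R v k) = 0"
proof (cases "inj_on v {..DIM('b)}")
  case True
  then have "dependent (v ` {..DIM('b)})"
    by (intro dependent_biggerset) (simp add: card_image)
  then obtain b where b: "\<exists>k\<le>DIM('b). b (v k) \<noteq> 0" "(\<Sum>k\<le>DIM('b). b (v k) *\<^sub>R v k) = 0"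
    using True by (auto simp: dependent_finite sum.reindex)
  define q where "q = (\<Sum>k\<le>DIM('b). monom (b (v k)) k)"
  have coeff: "coeff q k = (if k \<le> DIM('b) then b (v k) else 0)" for k
    by (simp add: q_def coeff_sum)
  have "degree q \<le> DIM('b)"
    by (intro degree_le) (simp add: coeff)
  moreover have "q \<noteq> 0"
    using b(1) coeff by (metis coeff_0)
  moreover have "(\<Sum>k\<le>DIM('b). coeff q k *\<^sub>R v k) = 0"
    using b(2) by (simp add: coeff)
  ultimately show ?thesis
    using sum_coeff_scaleR_upto_degree[of q "DIM('b)" v] by auto
next
  case False
  then obtain i j where ij: "i \<noteq> j" "v i = v j"
    by (auto simp: inj_on_def)
  define q :: "real poly" where "q = monom 1 i - monom 1 j"
  have coeff: "coeff q k = (if k = i then 1 else 0) - (if k = j then 1 else 0)" for k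
    by (simp add: q_def)
  have "degree q \<le> max i j"
    by (intro degree_le) (simp add: coeff)
  moreover have "q \<noteq> 0"
    using ij(1) coeff[of i] by auto
  moreover have "(\<Sum>k\<le>max i j. coeff q k *\<^sub>R v k) = 0"
    using ij(2)
    by (simp add: coeff scaleR_diff_left sum_subtractf if_distrib[of "\<lambda>c. c *\<^sub>R _"] cong: if_cong)
  ultimately show ?thesis
    using sum_coeff_scaleR_upto_degree[of q "max i j" v] by auto
qed

locale loop_quotient =
  dom: twisted_lie_algebra sc1 br1 \<rho> \<sigma> + cod: euclidean_lie_algebra sc2 br2 \<rho>
  for sc1 :: "'k::field \<Rightarrow> 'a::euclidean_space \<Rightarrow> 'a" and br1 \<rho> \<sigma>
    and sc2 :: "'k \<Rightarrow> 'b::euclidean_space \<Rightarrow> 'b" and br2 +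
  fixes \<psi> :: "(real \<Rightarrow> 'a) \<Rightarrow> 'b"
  assumes simple: "simple_lie sc2 br2"
    and hom_add: "u \<in> loop_alg \<sigma> \<Longrightarrow> v \<in> loop_alg \<sigma> \<Longrightarrow> \<psi> (\<lambda>t. u t + v t) = \<psi> u + \<psi> v"
    and hom_scale: "u \<in> loop_alg \<sigma> \<Longrightarrow> \<psi> (\<lambda>t. sc1 c (u t)) = sc2 c (\<psi> u)"
    and hom_bracket: "u \<in> loop_alg \<sigma> \<Longrightarrow> v \<in> loop_alg \<sigma> \<Longrightarrow> \<psi> (\<lambda>t. br1 (u t) (v t)) = br2 (\<psi> u) (\<psi> v)"
    and surj: "\<exists>u\<in>loop_alg \<sigma>. \<psi> u = y"
begin

abbreviation "L \<equiv> loop_alg \<sigma>"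

lemma hom_scaleR: "u \<in> L \<Longrightarrow> \<psi> (\<lambda>t. r *\<^sub>R u t) = r *\<^sub>R \<psi> u"
  using hom_scale[of u "\<rho> r"] by (simp add: dom.scale_real cod.scale_real)

lemma hom_zero: "\<psi> (\<lambda>_. 0) = 0"
  using hom_scaleR[OF dom.loop_zero, of 0] by simp

lemma hom_diff: "u \<in> L \<Longrightarrow> v \<in> L \<Longrightarrow> \<psi> (\<lambda>t. u t - v t) = \<psi> u - \<psi> v"
  using hom_add[OF _ dom.loop_scaleR[of v "-1"], of u] hom_scaleR[of v "-1"] by simp

lemma hom_sum: "(\<And>i. i \<in> I \<Longrightarrow> u i \<in> L) \<Longrightarrow> \<psi> (\<lambda>t. \<Sum>i\<in>I. u i t) = (\<Sum>i\<in>I. \<psi> (u i))"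
  by (induction I rule: infinite_finite_induct) (simp_all add: hom_zero hom_add dom.loop_sum)

lemma kernel_periodic_submodule:
  assumes f: "f \<in> periodic" and u: "u \<in> L" "\<psi> u = 0"
  shows "\<psi> (\<lambda>t. f t *\<^sub>R u t) = 0"
proof (rule cod.simple_center_trivial[OF simple])
  fix y
  obtain v where v: "v \<in> L" "\<psi> v = y" using surj by blast
  have "br2 y (\<psi> (\<lambda>t. f t *\<^sub>R u t)) = \<psi> (\<lambda>t. br1 (v t) (f t *\<^sub>R u t))"
    using f u v by (simp add: hom_bracket dom.loop_periodic_scaleR)
  also have "\<dots> = \<psi> (\<lambda>t. br1 (f t *\<^sub>R v t) (u t))"
    by (simp add: dom.bracket.scaleR_left dom.bracket.scaleR_right)
  also have "\<dots> = 0"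
    using f u v by (simp add: hom_bracket dom.loop_periodic_scaleR cod.bracket.zero_right)
  finally show "br2 y (\<psi> (\<lambda>t. f t *\<^sub>R u t)) = 0" .
qed

definition action :: "(real \<Rightarrow> real) \<Rightarrow> 'b \<Rightarrow> 'b" where
  "action f y = \<psi> (\<lambda>t. f t *\<^sub>R (SOME u. u \<in> L \<and> \<psi> u = y) t)"

lemma action_hom:
  assumes "f \<in> periodic" "u \<in> L"
  shows "action f (\<psi> u) = \<psi> (\<lambda>t. f t *\<^sub>R u t)"
proof -
  define v where "v = (SOME v. v \<in> L \<and> \<psi> v = \<psi> u)"
  have v: "v \<in> L" "\<psi> v = \<psi> u"
    using someI[of "\<lambda>v. v \<in> L \<and> \<psi> v = \<psi> u" u] assms(2) by (simp_all add: v_def)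
  have "\<psi> (\<lambda>t. f t *\<^sub>R v t) - \<psi> (\<lambda>t. f t *\<^sub>R u t) = \<psi> (\<lambda>t. f t *\<^sub>R (v t - u t))"
    using assms v by (simp add: hom_diff dom.loop_periodic_scaleR scaleR_diff_right)
  also have "\<dots> = 0"
    using assms v by (intro kernel_periodic_submodule) (simp_all add: dom.loop_diff hom_diff)
  finally show ?thesis by (simp add: action_def v_def)
qed

lemma linear_action:
  assumes f: "f \<in> periodic"
  shows "Vector_Spaces.linear sc2 sc2 (action f)"
proof -
  have "action f (x + y) = action f x + action f y" for x y
  proof -
    obtain u v where "u \<in> L" "\<psi> u = x" "v \<in> L" "\<psi> v = y" using surj by metis
    then show ?thesis
      using f action_hom[of f "\<lambda>t. u t + v t"]
      by (auto simp: action_hom hom_add dom.loop_add dom.loop_periodic_scaleR scaleR_add_right)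
  qed
  moreover have "action f (sc2 c x) = sc2 c (action f x)" for c x
  proof -
    obtain u where "u \<in> L" "\<psi> u = x" using surj by metis
    then show ?thesis
      using f action_hom[of f "\<lambda>t. sc1 c (u t)"]
      by (auto simp: action_hom hom_scale dom.loop_scale dom.loop_periodic_scaleR
          simp flip: dom.scale_scaleR)
  qed
  ultimately show ?thesis
    by (simp add: Vector_Spaces.linear_iff cod.vs.vector_space_axioms)
qed

lemma action_bracket:
  assumes f: "f \<in> periodic"
  shows "action f (br2 y x) = br2 y (action f x)"
proof -
  obtain u v where "u \<in> L" "\<psi> u = x" "v \<in> L" "\<psi> v = y" using surj by metis
  then show ?thesis
    using f action_hom[of f "\<lambda>t. br1 (v t) (u t)"]
    by (auto simp: action_hom hom_bracket dom.loop_bracket dom.loop_periodic_scaleR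
        simp flip: dom.bracket.scaleR_right)
qed

lemma action_add:
  assumes "f \<in> periodic" "g \<in> periodic"
  shows "action (\<lambda>t. f t + g t) y = action f y + action g y"
proof -
  obtain u where "u \<in> L" "\<psi> u = y" using surj by metis
  then show ?thesis
    using assms
    by (auto simp: action_hom hom_add periodic.loop_add dom.loop_periodic_scaleR scaleR_add_left)
qed

lemma action_mult:
  assumes "f \<in> periodic" "g \<in> periodic"
  shows "action (\<lambda>t. f t * g t) y = action f (action g y)"
proof -
  obtain u where "u \<in> L" "\<psi> u = y" using surj by metis
  then show ?thesis
    using assms by (auto simp: action_hom periodic_mult dom.loop_periodic_scaleR)
qed

lemma action_const: "action (\<lambda>_. r) y = r *\<^sub>R y"
proof -
  obtain u where "u \<in> L" "\<psi> u = y" using surj by metis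
  then show ?thesis by (auto simp: action_hom periodic_const hom_scaleR)
qed

lemma action_poly:
  assumes f: "f \<in> periodic"
  shows "action (\<lambda>t. poly q (f t)) y = (\<Sum>k\<le>degree q. coeff q k *\<^sub>R action (\<lambda>t. f t ^ k) y)"
proof -
  obtain u where u: "u \<in> L" "\<psi> u = y" using surj by metis
  have pow: "(\<lambda>t. f t ^ k *\<^sub>R u t) \<in> L" for k
    by (intro dom.loop_periodic_scaleR periodic_power f u)
  have "action (\<lambda>t. poly q (f t)) y = \<psi> (\<lambda>t. \<Sum>k\<le>degree q. coeff q k *\<^sub>R (f t ^ k *\<^sub>R u t))"
    using action_hom[OF periodic_poly[OF f] u(1)] by (simp add: u(2) poly_altdef scaleR_sum_left)
  also have "\<dots> = (\<Sum>k\<le>degree q. coeff q k *\<^sub>R \<psi> (\<lambda>t. f t ^ k *\<^sub>R u t))"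
    by (simp only: hom_sum dom.loop_scaleR pow hom_scaleR)
  finally show ?thesis
    using action_hom[OF periodic_power[OF f] u(1)] by (simp add: u(2))
qed

definition annihilator :: "(real \<Rightarrow> real) set" where
  "annihilator = {f \<in> periodic. \<forall>y. action f y = 0}"

lemma action_eq_0_imp:
  assumes f: "f \<in> periodic" and "action f y = 0"
  shows "f \<in> annihilator \<or> y = 0"
  using cod.simple_centroid_zero_or_injective[OF simple linear_action[OF f] action_bracket[OF f]
    assms(2)] f by (auto simp: annihilator_def)

lemma nontrivial_quotient: "\<exists>y :: 'b. y \<noteq> 0"
  using simple cod.bracket.zero_right by (force simp: simple_lie_def)

sublocale annihilator: algebraic_prime_ideal annihilator
proof
  obtain y :: 'b where y: "y \<noteq> 0" using nontrivial_quotient by blast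
  show "(\<lambda>_. 1) \<notin> annihilator"
    using y by (auto simp: annihilator_def action_const)
  show "(\<lambda>t. f t + g t) \<in> annihilator" if "f \<in> annihilator" "g \<in> annihilator" for f g
    using that by (simp add: annihilator_def periodic.loop_add action_add)
  show "(\<lambda>t. f t * g t) \<in> annihilator" if "f \<in> annihilator" "g \<in> periodic" for f g
    using that by (simp add: annihilator_def periodic_mult action_mult)
  show "f \<in> annihilator \<or> g \<in> annihilator"
    if fg: "f \<in> periodic" "g \<in> periodic" "(\<lambda>t. f t * g t) \<in> annihilator" for f g
  proof -
    have "action f (action g y) = 0"
      using fg by (simp add: annihilator_def action_mult)
    then show ?thesis
      using action_eq_0_imp[OF fg(1)] action_eq_0_imp[OF fg(2), of y] y by blast
  qed
  show "\<exists>q. q \<noteq> 0 \<and> (\<lambda>t. poly q (f t)) \<in> annihilator" if f: "f \<in> periodic" for f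
  proof -
    obtain q :: "real poly" where "q \<noteq> 0" "(\<Sum>k\<le>degree q. coeff q k *\<^sub>R action (\<lambda>t. f t ^ k) y) = 0"
      using exists_poly_relation[of "\<lambda>k. action (\<lambda>t. f t ^ k) y"] by blast
    then show ?thesis
      using action_eq_0_imp[OF periodic_poly[OF f], of q y] y by (auto simp: action_poly f)
  qed
qed (auto simp: annihilator_def)

definition base_point :: real where
  "base_point = (SOME p. annihilator = {f \<in> periodic. f p = 0})"

lemma annihilator_eq: "annihilator = {f \<in> periodic. f base_point = 0}"
  unfolding base_point_def by (rule someI_ex[OF annihilator.eq_vanishing_ideal])

lemma action_eq_value_at_base_point:
  assumes f: "f \<in> periodic"
  shows "action f y = f base_point *\<^sub>R y"
proof -
  let ?g = "\<lambda>t. f t - f base_point"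
  have g: "?g \<in> periodic"
    by (intro periodic.loop_diff f periodic_const)
  have "action f y = action (\<lambda>t. ?g t + f base_point) y" by simp
  also have "\<dots> = action ?g y + f base_point *\<^sub>R y"
    by (simp only: action_add g periodic_const action_const)
  also have "action ?g y = 0"
    using g annihilator_eq by (auto simp: annihilator_def)
  finally show ?thesis by simp
qed

lemma hom_periodic_scaleR:
  "f \<in> periodic \<Longrightarrow> u \<in> L \<Longrightarrow> \<psi> (\<lambda>t. f t *\<^sub>R u t) = f base_point *\<^sub>R \<psi> u"
  by (metis action_hom action_eq_value_at_base_point)

theorem factors_through_evaluation:
  assumes u: "u \<in> L" "u base_point = 0"
  shows "\<psi> u = 0"
proof -
  let ?p = base_point
  let ?e = "\<lambda>t. (loop_bump (\<lambda>x. x) ?p 1 t)\<^sup>2 :: real"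
  let ?c = "local_coordinate ?p u"
  have "\<psi> u = ?e ?p *\<^sub>R \<psi> u" by simp
  also have "\<dots> = \<psi> (\<lambda>t. ?e t *\<^sub>R u t)"
    by (intro hom_periodic_scaleR[symmetric] periodic_power periodic.loop_bump_in_loop_alg u)
  also have "\<dots> = \<psi> (\<lambda>t. \<Sum>b\<in>Basis. ?c b t *\<^sub>R loop_bump \<sigma> ?p b t)"
    by (simp only: dom.square_bump_scaleR_eq_sum_Basis[OF u(1)])
  also have "\<dots> = (\<Sum>b\<in>Basis. ?c b ?p *\<^sub>R \<psi> (loop_bump \<sigma> ?p b))"
    by (simp only: hom_sum hom_periodic_scaleR dom.loop_periodic_scaleR
        periodic_local_coordinate[OF loop_alg_smooth[OF u(1)]] dom.loop_bump_in_loop_alg)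
  also have "\<dots> = 0"
    by (simp add: local_coordinate_eq u(2))
  finally show ?thesis .
qed

end

section \<open>Surjective homomorphisms\<close>

locale surjective_loop_hom =
  dom: twisted_lie_algebra sc1 br1 \<rho> \<sigma>1 + cod: twisted_lie_algebra sc2 br2 \<rho> \<sigma>2
  for sc1 :: "'k::field \<Rightarrow> 'a::euclidean_space \<Rightarrow> 'a" and br1 \<rho> \<sigma>1
    and sc2 :: "'k \<Rightarrow> 'b::euclidean_space \<Rightarrow> 'b" and br2 \<sigma>2 +
  fixes \<phi> :: "(real \<Rightarrow> 'a) \<Rightarrow> real \<Rightarrow> 'b"
  assumes simple: "simple_lie sc2 br2"
    and hom: "loop_hom sc1 br1 \<sigma>1 sc2 br2 \<sigma>2 \<phi>"
    and surj: "\<phi> ` loop_alg \<sigma>1 = loop_alg \<sigma>2"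
begin

sublocale eval: loop_quotient sc1 br1 \<rho> \<sigma>1 sc2 br2 "\<lambda>u. \<phi> u t" for t
proof
  show "\<exists>u\<in>loop_alg \<sigma>1. \<phi> u t = y" for y
  proof -
    have "loop_bump \<sigma>2 t y \<in> \<phi> ` loop_alg \<sigma>1"
      unfolding surj by (rule cod.loop_bump_in_loop_alg)
    then obtain u where "u \<in> loop_alg \<sigma>1" "\<phi> u = loop_bump \<sigma>2 t y" by force
    then show ?thesis by (intro bexI[of _ u]) simp_all
  qed
qed (use simple hom in \<open>simp_all add: loop_hom_def\<close>)

lemma image_smooth: "u \<in> loop_alg \<sigma>1 \<Longrightarrow> smooth_on UNIV (\<phi> u)"
  using surj by (blast intro: loop_alg_smooth)

lemma smooth_on_periodic_base_point:
  assumes f: "f \<in> periodic"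
  shows "smooth_on UNIV (\<lambda>t. f (eval.base_point t))"
proof (rule smooth_on_scalar_factor[OF open_UNIV])
  fix a
  obtain y :: 'b where "y \<noteq> 0" using eval.nontrivial_quotient by blast
  then obtain u where u: "u \<in> loop_alg \<sigma>1" "\<phi> u a \<noteq> 0" using eval.surj by metis
  have "\<phi> (\<lambda>s. f s *\<^sub>R u s) = (\<lambda>t. f (eval.base_point t) *\<^sub>R \<phi> u t)"
    by (rule ext) (rule eval.hom_periodic_scaleR[OF f u(1)])
  then have "smooth_on UNIV (\<lambda>t. f (eval.base_point t) *\<^sub>R \<phi> u t)"
    using image_smooth[OF dom.loop_periodic_scaleR[OF f u(1)]] by simp
  with image_smooth[OF u(1)] u(2)
  show "\<exists>v :: real \<Rightarrow> 'b. smooth_on UNIV v \<and> v a \<noteq> 0 \<and>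
      smooth_on UNIV (\<lambda>t. f (eval.base_point t) *\<^sub>R v t)"
    by blast
qed

definition factors_along :: "(real \<Rightarrow> real) \<Rightarrow> bool" where
  "factors_along \<theta> \<longleftrightarrow> (\<forall>u\<in>loop_alg \<sigma>1. \<forall>t. u (\<theta> t) = 0 \<longrightarrow> \<phi> u t = 0)"

lemma exists_smooth_factorization: "\<exists>\<theta>. smooth_on UNIV \<theta> \<and> factors_along \<theta>"
proof -
  obtain \<theta> where \<theta>: "smooth_on UNIV \<theta>" "\<And>t. cos (\<theta> t) = cos (eval.base_point t)"
    "\<And>t. sin (\<theta> t) = sin (eval.base_point t)"
    by (rule smooth_angle_lift[OF smooth_on_periodic_base_point[OF periodic_cos]
        smooth_on_periodic_base_point[OF periodic_sin]]) auto
  have "\<phi> u t = 0" if u: "u \<in> loop_alg \<sigma>1" "u (\<theta> t) = 0" for u t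
  proof (rule eval.factors_through_evaluation[OF u(1)])
    obtain n :: int where "eval.base_point t = \<theta> t + 2 * pi * n"
      using sin_cos_eq_iff[of "eval.base_point t" "\<theta> t"] \<theta>(2,3) by auto
    then show "u (eval.base_point t) = 0"
      using dom.loop_eq_shift_iff[OF u(1) dom.loop_zero] u(2) by simp
  qed
  with \<theta>(1) show ?thesis by (auto simp: factors_along_def)
qed

definition fibre_map :: "(real \<Rightarrow> real) \<Rightarrow> real \<Rightarrow> 'a \<Rightarrow> 'b" where
  "fibre_map \<theta> t x = \<phi> (loop_bump \<sigma>1 (\<theta> t) x) t"

lemma hom_eq_fibre_map:
  assumes \<theta>: "factors_along \<theta>" and u: "u \<in> loop_alg \<sigma>1"
  shows "\<phi> u t = fibre_map \<theta> t (u (\<theta> t))"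
proof -
  let ?w = "loop_bump \<sigma>1 (\<theta> t) (u (\<theta> t))"
  have "\<phi> (\<lambda>s. u s - ?w s) t = 0"
    using \<theta> dom.loop_diff[OF u dom.loop_bump_in_loop_alg] by (simp add: factors_along_def)
  then show ?thesis
    by (simp add: fibre_map_def eval.hom_diff u dom.loop_bump_in_loop_alg)
qed

lemma lie_hom_fibre_map:
  assumes \<theta>: "factors_along \<theta>"
  shows "lie_hom sc1 br1 sc2 br2 (fibre_map \<theta> t)"
proof -
  let ?w = "loop_bump \<sigma>1 (\<theta> t)"
  note w = dom.loop_bump_in_loop_alg and fibre_map_eq = hom_eq_fibre_map[OF \<theta>, symmetric]
  have "fibre_map \<theta> t (x + y) = fibre_map \<theta> t x + fibre_map \<theta> t y" for x y
    using fibre_map_eq[OF dom.loop_add[OF w w], of t "\<theta> t" x "\<theta> t" y]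
    by (simp add: eval.hom_add w fibre_map_def)
  moreover have "fibre_map \<theta> t (sc1 c x) = sc2 c (fibre_map \<theta> t x)" for c x
    using fibre_map_eq[OF dom.loop_scale[OF w], of t c "\<theta> t" x]
    by (simp add: eval.hom_scale w fibre_map_def)
  moreover have "fibre_map \<theta> t (br1 x y) = br2 (fibre_map \<theta> t x) (fibre_map \<theta> t y)" for x y
    using fibre_map_eq[OF dom.loop_bracket[OF w w], of t "\<theta> t" x "\<theta> t" y]
    by (simp add: eval.hom_bracket w fibre_map_def)
  ultimately show ?thesis
    by (simp add: lie_hom_def Vector_Spaces.linear_iff dom.vs.vector_space_axioms
        cod.vs.vector_space_axioms)
qed

lemma smooth_on_fibre_map:
  assumes \<theta>: "factors_along \<theta>" and smooth: "smooth_on UNIV \<theta>"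
  shows "smooth_on UNIV (\<lambda>t. fibre_map \<theta> t x)"
proof (rule smooth_on_locally)
  fix a
  define u where "u = loop_bump \<sigma>1 (\<theta> a) x"
  define T where "T = \<theta> -` {\<theta> a - 1<..<\<theta> a + 1}"
  have u: "u \<in> loop_alg \<sigma>1"
    by (simp add: u_def dom.loop_bump_in_loop_alg)
  have "open T"
    unfolding T_def by (intro open_vimage smooth_on_imp_continuous_on[OF smooth]) simp
  have bump_pos_T: "bump (\<theta> t - \<theta> a) > 0" if "t \<in> T" for t
    using that by (intro bump_pos) (auto simp: T_def)
  have "smooth_on T (\<lambda>t. bump (\<theta> t - \<theta> a))"
    by (intro smooth_on_bump smooth_on_diff smooth_on_const smooth_on_subset[OF smooth] \<open>open T\<close>) simp
  then have "smooth_on T (\<lambda>t. inverse (bump (\<theta> t - \<theta> a)) *\<^sub>R \<phi> u t)"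
    by (intro smooth_on_scaleR smooth_on_inverse smooth_on_subset[OF image_smooth[OF u]] \<open>open T\<close>
        less_imp_neq[OF bump_pos_T, symmetric]) auto
  moreover have "inverse (bump (\<theta> t - \<theta> a)) *\<^sub>R \<phi> u t = fibre_map \<theta> t x" if t: "t \<in> T" for t
  proof -
    let ?c = "inverse (bump (\<theta> t - \<theta> a))"
    have "u (\<theta> t) = bump (\<theta> t - \<theta> a) *\<^sub>R x"
      unfolding u_def using t pi_gt3 by (intro loop_bump_eq) (auto simp: T_def)
    then have "?c *\<^sub>R u (\<theta> t) = x"
      using bump_pos_T[OF t] by simp
    then show ?thesis
      using hom_eq_fibre_map[OF \<theta> dom.loop_scaleR[OF u], of ?c t] eval.hom_scaleR[OF u] by simp
  qed
  ultimately have "smooth_on T (\<lambda>t. fibre_map \<theta> t x)"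
    by (rule smooth_on_cong[OF \<open>open T\<close>, rotated])
  moreover have "a \<in> T" by (simp add: T_def)
  ultimately show "\<exists>T. a \<in> T \<and> smooth_on T (\<lambda>t. fibre_map \<theta> t x)" by blast
qed

theorem standard: "standard_hom sc1 br1 \<sigma>1 sc2 br2 \<phi>"
proof -
  obtain \<theta> where \<theta>: "smooth_on UNIV \<theta>" "factors_along \<theta>"
    using exists_smooth_factorization by blast
  show ?thesis
    unfolding standard_hom_def smooth_fun_iff_smooth_on
    using \<theta>(1) lie_hom_fibre_map[OF \<theta>(2)] smooth_on_fibre_map[OF \<theta>(2,1)] hom_eq_fibre_map[OF \<theta>(2)]
    by blast
qed

end

theorem theorem2p9:
  shows
  "(\<forall>(br1 :: 'a::euclidean_space \<Rightarrow> 'a \<Rightarrow> 'a) \<sigma>1 (br2 :: 'b::euclidean_space \<Rightarrow> 'b \<Rightarrow> 'b) \<sigma>2 \<phi>.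
      lie_algebra scaleR br1 \<and> lie_algebra scaleR br2 \<and> simple_lie scaleR br2
      \<and> lie_aut scaleR br1 \<sigma>1 \<and> lie_aut scaleR br2 \<sigma>2
      \<and> loop_hom scaleR br1 \<sigma>1 scaleR br2 \<sigma>2 \<phi>
      \<and> \<phi> ` loop_alg \<sigma>1 = loop_alg \<sigma>2
      \<longrightarrow> standard_hom scaleR br1 \<sigma>1 scaleR br2 \<phi>)
 \<and> (\<forall>(sc1 :: complex \<Rightarrow> 'c::euclidean_space \<Rightarrow> 'c) (br1 :: 'c \<Rightarrow> 'c \<Rightarrow> 'c) \<sigma>1
      (sc2 :: complex \<Rightarrow> 'd::euclidean_space \<Rightarrow> 'd) (br2 :: 'd \<Rightarrow> 'd \<Rightarrow> 'd) \<sigma>2 \<phi>.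
      (\<forall>r x. sc1 (complex_of_real r) x = r *\<^sub>R x)
      \<and> (\<forall>r y. sc2 (complex_of_real r) y = r *\<^sub>R y)
      \<and> lie_algebra sc1 br1 \<and> lie_algebra sc2 br2 \<and> simple_lie sc2 br2
      \<and> lie_aut sc1 br1 \<sigma>1 \<and> lie_aut sc2 br2 \<sigma>2
      \<and> loop_hom sc1 br1 \<sigma>1 sc2 br2 \<sigma>2 \<phi>
      \<and> \<phi> ` loop_alg \<sigma>1 = loop_alg \<sigma>2
      \<longrightarrow> standard_hom sc1 br1 \<sigma>1 sc2 br2 \<phi>)"
proof (intro conjI allI impI, goal_cases)
  case (1 br1 \<sigma>1 br2 \<sigma>2 \<phi>)
  then interpret surjective_loop_hom scaleR br1 "\<lambda>r. r" \<sigma>1 scaleR br2 \<sigma>2 \<phi>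
    by unfold_locales auto
  show ?case by (rule standard)
next
  case (2 sc1 br1 \<sigma>1 sc2 br2 \<sigma>2 \<phi>)
  then interpret surjective_loop_hom sc1 br1 complex_of_real \<sigma>1 sc2 br2 \<sigma>2 \<phi>
    by unfold_locales auto
  show ?case by (rule standard)
qed

end
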